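(* Let $n$ be an integer and let $G_{n}=\langle s,t\mid swt^{-1}w^{-1}=1\rangle$ with $w=(ts^{-1}tst^{-1}s)^n$ (this is the fundamental group of the exterior of the two-bridge knot with Conway's notation $C(2n,3)$). For $M\in\mathbb{C}\setminus\{0\}$ and $x\in\mathbb{C}$ define \[ \rho(s)=\begin{pmatrix} M & 1\\ 0 & M^{-1}\end{pmatrix},\qquad \rho(t)=\begin{pmatrix} M & 0\\ 2-M^{2}-M^{-2}-x & M^{-1}\end{pmatrix}. \] Then $\rho$ defines a representation $G_n\to \mathrm{SL}(2,\mathbb{C})$ if and only if $x$ is a root of the Riley–Mednykh polynomial $P_{2n}=P_{2n}(x,M)$ given explicitly by \[ P_{2n}=\sum_{i=0}^{2n}\binom{n+\lfloor i/2\rfloor}{i}M^{4n}\left(M^{2}+M^{-2}+x-1\right)^{i}(-x)^{\lfloor (1+i)/2\rfloor}\quad\text{if } n\ge 0, \] \[ P_{2n}=\sum_{i=0}^{-2n-1}\binom{-n+\lfloor (i-1)/2\rfloor}{i}M^{-4n-2}\left(-M^{2}-M^{-2}-x+1\right)^{i}(-x)^{\lfloor (1+i)/2\rfloor}\quad\text{if } n<0. \]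
   Context: $\binom{a}{b}$ denotes the usual binomial coefficient and $\lfloor\cdot\rfloor$ the floor function. "$\rho$ defines a representation" means that the assignment on the generators $s,t$ respects the relation $swt^{-1}w^{-1}=1$. *)

theory Defs
  imports "HOL-Analysis.Analysis"
begin

type_synonym cmat = "complex^2^2"

text \<open>Integer powers of a 2x2 complex matrix (negative exponents via the matrix inverse).\<close>
definition mpow_int :: "cmat \<Rightarrow> int \<Rightarrow> cmat" where
  "mpow_int A k = (if 0 \<le> k then ((\<lambda>B. A ** B) ^^ nat k) (mat 1)
                   else ((\<lambda>B. matrix_inv A ** B) ^^ nat (- k)) (mat 1))"

definition rho_s :: "complex \<Rightarrow> cmat" where
  "rho_s M = vector [vector [M, 1], vector [0, inverse M]]"

definition rho_t :: "complex \<Rightarrow> complex \<Rightarrow> cmat" where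
  "rho_t M x = vector [vector [M, 0], vector [2 - M^2 - inverse (M^2) - x, inverse M]]"

text \<open>The word w = (t s^-1 t s t^-1 s)^n evaluated at matrices S, T.\<close>
definition word_w :: "int \<Rightarrow> cmat \<Rightarrow> cmat \<Rightarrow> cmat" where
  "word_w n S T = mpow_int (T ** matrix_inv S ** T ** S ** matrix_inv T ** S) n"

text \<open>The assignment s \<mapsto> S, t \<mapsto> T respects the relation s w t^-1 w^-1 = 1.\<close>
definition defines_rep :: "int \<Rightarrow> cmat \<Rightarrow> cmat \<Rightarrow> bool" where
  "defines_rep n S T \<longleftrightarrow>
     S ** word_w n S T ** matrix_inv T ** matrix_inv (word_w n S T) = mat 1"

text \<open>Riley--Mednykh polynomial P_{2n}(x,M).\<close>
definition riley_mednykh :: "int \<Rightarrow> complex \<Rightarrow> complex \<Rightarrow> complex" where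
  "riley_mednykh n x M =
    (if 0 \<le> n then
       (\<Sum>i = 0..nat (2*n). of_nat (nat (n + int (i div 2)) choose i) * M^(nat (4*n))
          * (M^2 + inverse (M^2) + x - 1)^i * (- x)^((1 + i) div 2))
     else
       (\<Sum>i = 0..nat (-2*n - 1). of_nat (nat (- n + (int i - 1) div 2) choose i)
          * M^(nat (-4*n - 2))
          * (- (M^2) - inverse (M^2) - x + 1)^i * (- x)^((1 + i) div 2)))"

end

theory Submission
  imports Defs
begin

text \<open>Let A = \<rho>(t s^-1 t s t^-1 s), so that \<rho>(w) = A^n, and put u = M^2 + M^-2 + x - 1.
  A direct computation gives det A = 1, tr A = 2 - x u^2, and the lower left entry of A is
  1 - u times its upper right entry, exactly as for \<rho>(t). By Cayley--Hamilton
  A^k = s_k A - s_(k-1) I, where s_(k+1) = (tr A) s_k - s_(k-1); these s_k are the sums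
  \<Sum>_j (k+j choose 2j+1) v^j with v = -x u^2. Thanks to the shared shape, the relation
  \<rho>(s) A^k = A^k \<rho>(t) collapses to a single scalar equation in s_k and s_(k+1), and splitting
  the sum defining P_2n into even and odd indices shows that this equation is P_2n = 0 up to a
  power of M. For n < 0 the same argument applies to A^-1, which has the same shape.\<close>

text \<open>binom_odd_sum v k = U_(k-1)(1 + v/2), a Chebyshev polynomial of the second kind.\<close>

definition binom_odd_sum :: "'a::comm_semiring_1 \<Rightarrow> nat \<Rightarrow> 'a" where
  "binom_odd_sum v k = (\<Sum>j\<le>k. of_nat ((k + j) choose (2*j + 1)) * v^j)"

definition binom_even_sum :: "'a::comm_semiring_1 \<Rightarrow> nat \<Rightarrow> 'a" where
  "binom_even_sum v k = (\<Sum>j\<le>k. of_nat ((k + j) choose (2*j)) * v^j)"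

lemma binom_odd_sum_0 [simp]: "binom_odd_sum v 0 = 0"
  by (simp add: binom_odd_sum_def)

lemma binom_odd_sum_1 [simp]: "binom_odd_sum v (Suc 0) = 1"
  by (simp add: binom_odd_sum_def binomial_eq_0)

lemma binom_odd_sum_Suc:
  "binom_odd_sum v (Suc k) = binom_odd_sum v k + binom_even_sum v k"
proof -
  have "binom_odd_sum v (Suc k) = (\<Sum>j\<le>k. of_nat ((Suc k + j) choose (2*j + 1)) * v^j)"
    by (simp add: binom_odd_sum_def binomial_eq_0)
  also have "\<dots> = (\<Sum>j\<le>k. of_nat ((k + j) choose (2*j + 1)) * v^j + of_nat ((k + j) choose (2*j)) * v^j)"
    by (intro sum.cong) (simp_all add: algebra_simps)
  finally show ?thesis
    by (simp add: sum.distrib binom_odd_sum_def binom_even_sum_def)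
qed

lemma binom_even_sum_Suc:
  "binom_even_sum v (Suc k) = binom_even_sum v k + v * binom_odd_sum v (Suc k)"
proof -
  have "binom_even_sum v (Suc k)
      = 1 + (\<Sum>j\<le>k. of_nat ((Suc k + Suc j) choose (2*Suc j)) * v^Suc j)"
    unfolding binom_even_sum_def by (subst sum.atMost_Suc_shift) simp
  also have "\<dots> = 1 + (\<Sum>j\<le>k. of_nat ((k + Suc j) choose (2*Suc j)) * v^Suc j)
      + v * (\<Sum>j\<le>k. of_nat ((Suc k + j) choose (2*j + 1)) * v^j)"
    by (simp add: sum_distrib_left sum.distrib[symmetric] algebra_simps numeral_2_eq_2)
  also have "1 + (\<Sum>j\<le>k. of_nat ((k + Suc j) choose (2*Suc j)) * v^Suc j)
      = (\<Sum>j\<le>Suc k. of_nat ((k + j) choose (2*j)) * v^j)"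
    by (subst sum.atMost_Suc_shift) simp
  also have "\<dots> = binom_even_sum v k"
    by (simp add: binom_even_sum_def binomial_eq_0)
  also have "(\<Sum>j\<le>k. of_nat ((Suc k + j) choose (2*j + 1)) * v^j) = binom_odd_sum v (Suc k)"
    by (simp add: binom_odd_sum_def binomial_eq_0)
  finally show ?thesis .
qed

lemma binom_odd_sum_rec:
  fixes v :: "'a::comm_ring_1"
  shows "binom_odd_sum v (Suc (Suc k)) = (2 + v) * binom_odd_sum v (Suc k) - binom_odd_sum v k"
  using binom_odd_sum_Suc[of v "Suc k"] binom_odd_sum_Suc[of v k] binom_even_sum_Suc[of v k]
  by (simp add: algebra_simps)

definition mat2 :: "'a::zero \<Rightarrow> 'a \<Rightarrow> 'a \<Rightarrow> 'a \<Rightarrow> 'a^2^2" where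
  "mat2 a b c d = vector [vector [a, b], vector [c, d]]"

lemma mat2_nth [simp]:
  "mat2 a b c d $ 1 $ 1 = a" "mat2 a b c d $ 1 $ 2 = b"
  "mat2 a b c d $ 2 $ 1 = c" "mat2 a b c d $ 2 $ 2 = d"
  by (simp_all add: mat2_def)

lemma mat2_eq_iff: "mat2 a b c d = mat2 a' b' c' d' \<longleftrightarrow> a = a' \<and> b = b' \<and> c = c' \<and> d = d'"
  by (metis mat2_nth)

lemma mat2_eta: "A = mat2 (A$1$1) (A$1$2) (A$2$1) (A$2$2)"
  by (simp add: vec_eq_iff forall_2)

lemma mat2_mult:
  fixes a b c d :: "'a::semiring_1"
  shows "mat2 a b c d ** mat2 e f g h = mat2 (a*e + b*g) (a*f + b*h) (c*e + d*g) (c*f + d*h)"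
  by (simp add: vec_eq_iff forall_2 matrix_matrix_mult_def sum_2)

lemma mat1_eq_mat2: "(mat 1 :: 'a::semiring_1^2^2) = mat2 1 0 0 1"
  by (simp add: vec_eq_iff forall_2 mat_def)

lemma matrix_inv_unique:
  fixes A :: "'a::semiring_1^'n^'n"
  assumes "A ** B = mat 1" "B ** A = mat 1"
  shows "matrix_inv A = B"
proof -
  have inv: "A ** matrix_inv A = mat 1 \<and> matrix_inv A ** A = mat 1"
    unfolding matrix_inv_def by (rule someI[of _ B]) (use assms in blast)
  then have "matrix_inv A = matrix_inv A ** (A ** B)"
    using assms by simp
  also have "\<dots> = B"
    by (simp add: matrix_mul_assoc inv)
  finally show ?thesis .
qed

lemma invertible_matrix_inv:
  fixes A :: "'a::semiring_1^'n^'n"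
  assumes "invertible A"
  shows "A ** matrix_inv A = mat 1" "matrix_inv A ** A = mat 1" "invertible (matrix_inv A)"
proof -
  show *: "A ** matrix_inv A = mat 1" "matrix_inv A ** A = mat 1"
    using someI_ex[OF assms[unfolded invertible_def]] by (auto simp: matrix_inv_def)
  show "invertible (matrix_inv A)"
    using * unfolding invertible_def by blast
qed

lemma matrix_inv_mat2:
  fixes a b c d :: "'a::comm_ring_1"
  assumes "a*d - b*c = 1"
  shows "matrix_inv (mat2 a b c d) = mat2 d (-b) (-c) a" "invertible (mat2 a b c d)"
proof -
  have "mat2 a b c d ** mat2 d (-b) (-c) a = mat 1" "mat2 d (-b) (-c) a ** mat2 a b c d = mat 1"
    using assms by (auto simp: mat2_mult mat1_eq_mat2 mat2_eq_iff algebra_simps)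
  then show "matrix_inv (mat2 a b c d) = mat2 d (-b) (-c) a" "invertible (mat2 a b c d)"
    unfolding invertible_def by (auto intro: matrix_inv_unique)
qed

lemma invertible_funpow_mult:
  fixes A :: "'a::semiring_1^'n^'n"
  assumes "invertible A"
  shows "invertible (((**) A ^^ k) (mat 1))"
proof (induction k)
  case 0
  show ?case unfolding invertible_def by (auto intro: exI[of _ "mat 1"])
next
  case (Suc k)
  then show ?case using invertible_mult[OF assms] by simp
qed

lemma mpow_int_of_nat: "mpow_int A (int k) = ((**) A ^^ k) (mat 1)"
  by (simp add: mpow_int_def)

lemma mpow_int_minus_of_nat: "mpow_int A (- int k) = ((**) (matrix_inv A) ^^ k) (mat 1)"
  by (cases "k = 0") (simp_all add: mpow_int_def)

lemma invertible_mpow_int: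
  assumes "invertible A"
  shows "invertible (mpow_int A n)"
proof (cases "0 \<le> n")
  case True
  then show ?thesis
    using invertible_funpow_mult[OF assms] by (metis nonneg_int_cases mpow_int_of_nat)
next
  case False
  then obtain k where "n = - int k"
    by (metis nle_le nonpos_int_cases)
  then show ?thesis
    using invertible_funpow_mult[OF invertible_matrix_inv(3)[OF assms]] by (simp add: mpow_int_minus_of_nat)
qed

lemma relator_eq_1_iff:
  fixes S T W :: "'a::semiring_1^'n^'n"
  assumes "invertible W" "invertible T"
  shows "S ** W ** matrix_inv T ** matrix_inv W = mat 1 \<longleftrightarrow> S ** W = W ** T"
proof -
  note W = invertible_matrix_inv[OF assms(1)] and T = invertible_matrix_inv[OF assms(2)]
  have "X ** matrix_inv W = mat 1 \<longleftrightarrow> X = W" for X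
    by (metis W(1,2) matrix_mul_assoc matrix_mul_lid matrix_mul_rid)
  moreover have "Y ** matrix_inv T = W \<longleftrightarrow> Y = W ** T" for Y
    by (metis T(1,2) matrix_mul_assoc matrix_mul_rid)
  ultimately show ?thesis by simp
qed

text \<open>Cayley--Hamilton A^k = s_k A - s_(k-1) I, with s_(k-1) rewritten as (a + d) s_k - s_(k+1)
  so that the case k = 0 needs no special treatment.\<close>

lemma mat2_power:
  fixes a b c d :: "'a::comm_ring_1"
  assumes det: "a*d - b*c = 1" and s0: "s 0 = 0" and s1: "s (Suc 0) = 1"
    and s_rec: "\<And>k. s (Suc (Suc k)) = (a + d) * s (Suc k) - s k"
  shows "((**) (mat2 a b c d) ^^ k) (mat 1)
    = mat2 (s (Suc k) - s k * d) (s k * b) (s k * c) (s (Suc k) - s k * a)"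
proof (induction k)
  case 0
  show ?case by (simp add: s0 s1 mat1_eq_mat2)
next
  case (Suc k)
  have "((**) (mat2 a b c d) ^^ Suc k) (mat 1)
      = mat2 a b c d ** mat2 (s (Suc k) - s k * d) (s k * b) (s k * c) (s (Suc k) - s k * a)"
    by (simp add: Suc.IH)
  also have "\<dots> = mat2 (a * s (Suc k) - s k * (a*d - b*c)) (s (Suc k) * b)
      (s (Suc k) * c) (d * s (Suc k) - s k * (a*d - b*c))"
    by (simp add: mat2_mult mat2_eq_iff algebra_simps)
  also have "\<dots> = mat2 (s (Suc (Suc k)) - s (Suc k) * d) (s (Suc k) * b)
      (s (Suc k) * c) (s (Suc (Suc k)) - s (Suc k) * a)"
    by (simp add: det s_rec algebra_simps)
  finally show ?case .
qed

lemma mat2_intertwines_iff: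
  fixes M c p q r :: "'a::field"
  shows "mat2 M 1 0 (inverse M) ** mat2 p q (c*q) r = mat2 p q (c*q) r ** mat2 M 0 c (inverse M)
    \<longleftrightarrow> M*q + r - inverse M * q = 0"
proof -
  have "mat2 M 1 0 (inverse M) ** mat2 p q (c*q) r = mat2 p q (c*q) r ** mat2 M 0 c (inverse M)
    \<longleftrightarrow> M*q + r = q * inverse M \<and> inverse M * (c*q) = c*q*M + r*c"
    by (auto simp: mat2_mult mat2_eq_iff algebra_simps)
  also have "\<dots> \<longleftrightarrow> r = q * inverse M - M*q"
  proof
    assume r: "r = q * inverse M - M*q"
    show "M*q + r = q * inverse M \<and> inverse M * (c*q) = c*q*M + r*c"
      unfolding r by (simp add: algebra_simps)
  qed (simp add: algebra_simps)
  also have "\<dots> \<longleftrightarrow> M*q + r - inverse M * q = 0"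
    by (auto simp: algebra_simps)
  finally show ?thesis .
qed

lemma mat2_power_intertwines_iff:
  fixes a b c d M :: "'a::field" and k :: nat
  assumes det: "a*d - b*(c*b) = 1" and s0: "s 0 = 0" and s1: "s (Suc 0) = 1"
    and s_rec: "\<And>k. s (Suc (Suc k)) = (a + d) * s (Suc k) - s k"
  defines "P \<equiv> ((**) (mat2 a b (c*b) d) ^^ k) (mat 1)"
  shows "mat2 M 1 0 (inverse M) ** P = P ** mat2 M 0 c (inverse M)
    \<longleftrightarrow> s (Suc k) + s k * ((M - inverse M) * b - a) = 0"
proof -
  have "P = mat2 (s (Suc k) - s k * d) (s k * b) (c * (s k * b)) (s (Suc k) - s k * a)"
    unfolding P_def mat2_power[OF det s0 s1 s_rec] by (simp add: ac_simps)
  then show ?thesis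
    by (simp only: mat2_intertwines_iff) (simp add: algebra_simps)
qed

definition word_base :: "cmat \<Rightarrow> cmat \<Rightarrow> cmat" where
  "word_base S T = T ** matrix_inv S ** T ** S ** matrix_inv T ** S"

lemma word_w_eq_mpow_int: "word_w n S T = mpow_int (word_base S T) n"
  by (simp add: word_w_def word_base_def)

lemma rho_s_eq_mat2: "rho_s M = mat2 M 1 0 (inverse M)"
  by (simp add: rho_s_def mat2_def)

lemma rho_t_eq_mat2: "rho_t M x = mat2 M 0 (1 - (M^2 + inverse (M^2) + x - 1)) (inverse M)"
  by (simp add: rho_t_def mat2_def algebra_simps)

lemma word_base_rho:
  fixes M x :: complex
  assumes M: "M \<noteq> 0"
  defines "u \<equiv> M^2 + inverse (M^2) + x - 1"
  obtains a b d where "word_base (rho_s M) (rho_t M x) = mat2 a b ((1 - u) * b) d"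
    and "a*d - b*((1 - u) * b) = 1" and "a + d = 2 - x*u^2"
    and "(M - inverse M) * b + d = 1 - x*u - x*u^2"
proof -
  define c where "c = 1 - u"
  define W where "W = word_base (rho_s M) (rho_t M x)"
  have "W = mat2 M 0 c (inverse M) ** mat2 (inverse M) (-1) 0 M ** mat2 M 0 c (inverse M)
      ** mat2 M 1 0 (inverse M) ** mat2 (inverse M) 0 (-c) M ** mat2 M 1 0 (inverse M)"
    unfolding W_def word_base_def rho_s_eq_mat2 rho_t_eq_mat2 u_def[symmetric] c_def[symmetric]
    using M by (simp add: matrix_inv_mat2)
  note W_entries = this[unfolded mat2_mult mat2_nth]
  show thesis
  proof (rule that)
    have "W$2$1 = c * W$1$2"
      unfolding W_entries using M by (simp add: field_simps)
    then show "word_base (rho_s M) (rho_t M x) = mat2 (W$1$1) (W$1$2) ((1 - u) * W$1$2) (W$2$2)"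
      by (metis W_def c_def mat2_eta)
    show "W$1$1 * W$2$2 - W$1$2 * ((1 - u) * W$1$2) = 1"
      unfolding W_entries c_def using M by (simp add: field_simps)
    show "W$1$1 + W$2$2 = 2 - x*u^2"
      unfolding W_entries c_def u_def using M by (simp add: field_simps power2_eq_square)
    show "(M - inverse M) * W$1$2 + W$2$2 = 1 - x*u - x*u^2"
      unfolding W_entries c_def u_def using M by (simp add: field_simps power2_eq_square)
  qed
qed

lemma power_double_mult: "u^(2*j) * y^j = (y * u^2 :: 'a::comm_monoid_mult)^j"
  by (metis mult.commute power_mult power_mult_distrib)

lemma riley_mednykh_nonneg:
  fixes M x :: complex
  defines "u \<equiv> M^2 + inverse (M^2) + x - 1"
  shows "riley_mednykh (int k) x M
    = M^(4*k) * (binom_even_sum (-x*u^2) k - x*u * binom_odd_sum (-x*u^2) k)"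
proof -
  define h where "h i = of_nat ((k + i div 2) choose i) * M^(4*k) * u^i * (-x)^((1 + i) div 2)" for i
  have "riley_mednykh (int k) x M = (\<Sum>i=0..2*k. h i)"
    by (simp add: riley_mednykh_def h_def u_def nat_mult_distrib nat_add_distrib)
  also have "\<dots> = (\<Sum>i\<le>Suc (2*k). h i)"
    by (simp add: atLeast0AtMost h_def binomial_eq_0)
  also have "\<dots> = (\<Sum>j\<le>k. h (2*j) + h (Suc (2*j)))"
    by (rule sum.in_pairs_0)
  also have "\<dots> = (\<Sum>j\<le>k. M^(4*k) * (of_nat ((k + j) choose (2*j)) * (-x*u^2)^j
      - x*u * (of_nat ((k + j) choose (2*j + 1)) * (-x*u^2)^j)))"
  proof (intro sum.cong refl)
    fix j
    have "h (2*j) = of_nat ((k + j) choose (2*j)) * M^(4*k) * (u^(2*j) * (-x)^j)"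
      by (simp add: h_def mult.assoc)
    moreover have "h (Suc (2*j)) = of_nat ((k + j) choose (2*j + 1)) * M^(4*k) * (- x*u) * (u^(2*j) * (-x)^j)"
      by (simp add: h_def power_add algebra_simps)
    ultimately show "h (2*j) + h (Suc (2*j)) = M^(4*k) * (of_nat ((k + j) choose (2*j)) * (-x*u^2)^j
      - x*u * (of_nat ((k + j) choose (2*j + 1)) * (-x*u^2)^j))"
      unfolding power_double_mult by (simp add: algebra_simps)
  qed
  finally show ?thesis
    by (simp add: binom_even_sum_def binom_odd_sum_def sum_distrib_left sum_subtractf right_diff_distrib)
qed

lemma riley_mednykh_neg:
  fixes M x :: complex
  defines "u \<equiv> M^2 + inverse (M^2) + x - 1"
  shows "riley_mednykh (- int (Suc k)) x M
    = M^(4*k + 2) * (binom_even_sum (-x*u^2) k + x*u * binom_odd_sum (-x*u^2) (Suc k))"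
proof -
  define h where "h i = of_nat (nat (int (Suc k) + (int i - 1) div 2) choose i) * M^(4*k + 2)
    * (-u)^i * (-x)^((1 + i) div 2)" for i
  have "riley_mednykh (- int (Suc k)) x M = (\<Sum>i\<le>Suc (2*k). h i)"
    by (simp add: riley_mednykh_def h_def u_def atLeast0AtMost nat_add_distrib nat_mult_distrib algebra_simps)
  also have "\<dots> = (\<Sum>j\<le>k. h (2*j) + h (Suc (2*j)))"
    by (rule sum.in_pairs_0)
  also have "\<dots> = (\<Sum>j\<le>k. M^(4*k + 2) * (of_nat ((k + j) choose (2*j)) * (-x*u^2)^j
      + x*u * (of_nat ((Suc k + j) choose (2*j + 1)) * (-x*u^2)^j)))"
  proof (intro sum.cong refl)
    fix j
    have "nat (int (Suc k) + (int (2*j) - 1) div 2) = k + j"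
      by simp
    then have "h (2*j) = of_nat ((k + j) choose (2*j)) * M^(4*k + 2) * (u^(2*j) * (-x)^j)"
      by (simp add: h_def mult.assoc)
    moreover have "h (Suc (2*j))
        = of_nat ((Suc k + j) choose (2*j + 1)) * M^(4*k + 2) * (x*u) * (u^(2*j) * (-x)^j)"
      by (simp add: h_def power_add nat_add_distrib algebra_simps del: binomial_Suc_Suc)
    ultimately show "h (2*j) + h (Suc (2*j)) = M^(4*k + 2) * (of_nat ((k + j) choose (2*j)) * (-x*u^2)^j
      + x*u * (of_nat ((Suc k + j) choose (2*j + 1)) * (-x*u^2)^j))"
      unfolding power_double_mult by (simp add: algebra_simps)
  qed
  moreover have "binom_odd_sum v (Suc k) = (\<Sum>j\<le>k. of_nat ((Suc k + j) choose (2*j + 1)) * v^j)"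
    for v :: complex
    by (simp add: binom_odd_sum_def binomial_eq_0)
  ultimately show ?thesis
    by (simp add: binom_even_sum_def sum_distrib_left sum.distrib distrib_left)
qed

lemma defines_rep_iff_intertwines:
  assumes "invertible S" and "invertible T"
  shows "defines_rep n S T \<longleftrightarrow> S ** word_w n S T = word_w n S T ** T"
proof -
  have "invertible (word_base S T)"
    unfolding word_base_def
    using assms invertible_matrix_inv(3)[OF assms(1)] invertible_matrix_inv(3)[OF assms(2)]
    by (simp add: invertible_mult)
  then show ?thesis
    unfolding defines_rep_def word_w_eq_mpow_int
    by (rule relator_eq_1_iff[OF invertible_mpow_int assms(2)])
qed

lemma invertible_rho_s: "M \<noteq> 0 \<Longrightarrow> invertible (rho_s M)"
  unfolding rho_s_eq_mat2 by (intro matrix_inv_mat2) simp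

lemma invertible_rho_t: "M \<noteq> 0 \<Longrightarrow> invertible (rho_t M x)"
  unfolding rho_t_eq_mat2 by (intro matrix_inv_mat2) simp

lemma defines_rep_rho_nonneg_iff:
  fixes M x :: complex
  assumes M: "M \<noteq> 0"
  defines "u \<equiv> M^2 + inverse (M^2) + x - 1"
  defines "s \<equiv> binom_odd_sum (-x*u^2)"
  shows "defines_rep (int k) (rho_s M) (rho_t M x) \<longleftrightarrow> binom_even_sum (-x*u^2) k - x*u * s k = 0"
proof -
  obtain a b d where W: "word_base (rho_s M) (rho_t M x) = mat2 a b ((1 - u) * b) d"
    and det: "a*d - b*((1 - u) * b) = 1" and tr: "a + d = 2 - x*u^2"
    and entry: "(M - inverse M) * b + d = 1 - x*u - x*u^2"
    using word_base_rho[OF M] unfolding u_def .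
  have "(M - inverse M) * b - a = ((M - inverse M) * b + d) - (a + d)"
    by simp
  also have "\<dots> = - 1 - x*u"
    unfolding entry tr by (simp add: algebra_simps)
  finally have coeff: "(M - inverse M) * b - a = - 1 - x*u" .
  have "defines_rep (int k) (rho_s M) (rho_t M x) \<longleftrightarrow> s (Suc k) + s k * ((M - inverse M) * b - a) = 0"
    unfolding defines_rep_iff_intertwines[OF invertible_rho_s[OF M] invertible_rho_t[OF M]]
      word_w_eq_mpow_int W mpow_int_of_nat
    unfolding rho_s_eq_mat2 rho_t_eq_mat2 u_def[symmetric]
    by (rule mat2_power_intertwines_iff) (use det in \<open>simp_all add: s_def tr binom_odd_sum_rec\<close>)
  also have "s (Suc k) + s k * ((M - inverse M) * b - a) = binom_even_sum (-x*u^2) k - x*u * s k"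
    unfolding coeff s_def by (simp add: binom_odd_sum_Suc algebra_simps)
  finally show ?thesis .
qed

lemma defines_rep_rho_neg_iff:
  fixes M x :: complex
  assumes M: "M \<noteq> 0"
  defines "u \<equiv> M^2 + inverse (M^2) + x - 1"
  defines "s \<equiv> binom_odd_sum (-x*u^2)"
  shows "defines_rep (- int (Suc k)) (rho_s M) (rho_t M x)
    \<longleftrightarrow> binom_even_sum (-x*u^2) k + x*u * s (Suc k) = 0"
proof -
  obtain a b d where W: "word_base (rho_s M) (rho_t M x) = mat2 a b ((1 - u) * b) d"
    and det: "a*d - b*((1 - u) * b) = 1" and tr: "a + d = 2 - x*u^2"
    and entry: "(M - inverse M) * b + d = 1 - x*u - x*u^2"
    using word_base_rho[OF M] unfolding u_def .
  have det': "d*a - (-b)*((1 - u) * (-b)) = 1" and tr': "d + a = 2 - x*u^2"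
    using det tr by (simp_all add: algebra_simps)
  have inv: "matrix_inv (mat2 a b ((1 - u) * b) d) = mat2 d (-b) ((1 - u) * (-b)) a"
    using matrix_inv_mat2(1)[OF det] by simp
  have "(M - inverse M) * (-b) - d = - ((M - inverse M) * b + d)"
    by simp
  then have coeff: "(M - inverse M) * (-b) - d = x*u + x*u^2 - 1"
    unfolding entry by simp
  have "defines_rep (- int (Suc k)) (rho_s M) (rho_t M x)
      \<longleftrightarrow> s (Suc (Suc k)) + s (Suc k) * ((M - inverse M) * (-b) - d) = 0"
    unfolding defines_rep_iff_intertwines[OF invertible_rho_s[OF M] invertible_rho_t[OF M]]
      word_w_eq_mpow_int W mpow_int_minus_of_nat inv
    unfolding rho_s_eq_mat2 rho_t_eq_mat2 u_def[symmetric]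
    by (rule mat2_power_intertwines_iff[OF det']) (simp_all add: s_def tr' binom_odd_sum_rec)
  also have "s (Suc (Suc k)) + s (Suc k) * ((M - inverse M) * (-b) - d)
      = binom_even_sum (-x*u^2) k + x*u * s (Suc k)"
    unfolding coeff s_def binom_odd_sum_rec by (simp add: binom_odd_sum_Suc[of _ k] algebra_simps)
  finally show ?thesis .
qed

theorem lemma1:
  fixes n :: int and M x :: complex
  assumes "M \<noteq> 0"
  shows "defines_rep n (rho_s M) (rho_t M x) \<longleftrightarrow> riley_mednykh n x M = 0"
proof (cases "0 \<le> n")
  case True
  then obtain k where n: "n = int k"
    by (metis nonneg_int_cases)
  show ?thesis
    unfolding n defines_rep_rho_nonneg_iff[OF assms] riley_mednykh_nonneg using assms by simp
next
  case False
  then obtain k where n: "n = - int (Suc k)"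
    using negD[of n] by auto
  show ?thesis
    unfolding n defines_rep_rho_neg_iff[OF assms] riley_mednykh_neg using assms by simp
qed

end
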